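(* Let $\mathcal{G}=(\mathcal{V},\mathcal{E})$ be a simple graph and let $k\ge2$ be an integer. Define a cubic form in $|\mathcal{V}|+|\mathcal{E}|+1$ variables by $$p_{\mathcal{G},k}(x_0,x,y)=\frac{2k}{k-1}x_0^3-x_0(\|x\|^2+\|y\|^2)+q_{\mathcal{G}}(x,y).$$ Then $p_{\mathcal{G},k}$ is hyperbolic with respect to $e_0$ if, and only if, $\omega(\mathcal{G})\le k$.
   Context: A simple graph is a finite undirected graph without loops or multiple edges; $\omega(\mathcal{G})$ is the size (number of vertices) of a largest clique in $\mathcal{G}$. The variables are $x_0\in\mathbb{R}$, $x=(x_i)_{i\in\mathcal{V}}\in\mathbb{R}^{\mathcal{V}}$ and $y=(y_{ij})_{\{i,j\}\in\mathcal{E}}\in\mathbb{R}^{\mathcal{E}}$, $\|\cdot\|$ is the Euclidean norm, and $$q_{\mathcal{G}}(x,y)=\sum_{\{i,j\}\in\mathcal{E}}x_ix_jy_{ij}$$ (each edge contributes once). $e_0$ is the standard basis vector with $x_0=1$, $x=0$, $y=0$. A homogeneous real polynomial $p$ on $\mathbb{R}^N$ is hyperbolic with respect to $e\in\mathbb{R}^N$ if $p(e)>0$ and for every $v\in\mathbb{R}^N$ the polynomial $t\mapsto p(v+te)$ has only real zeros. *)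

theory Defs
  imports Complex_Main "HOL-Library.Poly_Mapping" "HOL-Library.Ramsey"
begin

section \<open>Real polynomials in several variables\<close>

text \<open>
  A monomial is a finitely supported exponent map; a polynomial maps monomials to coefficients.
  Sums and products of polynomials are the ones of \<^typ>\<open>('i \<Rightarrow>\<^sub>0 nat) \<Rightarrow>\<^sub>0 real\<close>.
\<close>

type_synonym 'i rpoly = "('i \<Rightarrow>\<^sub>0 nat) \<Rightarrow>\<^sub>0 real"

definition pvar :: "'i \<Rightarrow> 'i rpoly" where
  "pvar i = Poly_Mapping.single (Poly_Mapping.single i 1) 1"

definition pconst :: "real \<Rightarrow> 'i rpoly" where
  "pconst c = Poly_Mapping.single 0 c"

definition pvars :: "'i rpoly \<Rightarrow> 'i set" where
  "pvars p = (\<Union>m\<in>Poly_Mapping.keys p. Poly_Mapping.keys m)"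

definition monom_degree :: "('i \<Rightarrow>\<^sub>0 nat) \<Rightarrow> nat" where
  "monom_degree m = (\<Sum>i\<in>Poly_Mapping.keys m. Poly_Mapping.lookup m i)"

definition homogeneous :: "'i rpoly \<Rightarrow> bool" where
  "homogeneous p \<longleftrightarrow> (\<exists>d. \<forall>m\<in>Poly_Mapping.keys p. monom_degree m = d)"

text \<open>Evaluation is needed both at real and at complex points.\<close>

definition peval :: "('i \<Rightarrow> 'b) \<Rightarrow> 'i rpoly \<Rightarrow> 'b::real_field" where
  "peval f p = (\<Sum>m\<in>Poly_Mapping.keys p. of_real (Poly_Mapping.lookup p m) *
     (\<Prod>i\<in>Poly_Mapping.keys m. f i ^ Poly_Mapping.lookup m i))"


section \<open>Hyperbolic polynomials\<close>

text \<open>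
  For a finite set \<open>I\<close> of coordinates, \<open>\<real>\<^sup>I\<close> is represented by the functions vanishing outside \<open>I\<close>.
\<close>

definition coord_space :: "'i set \<Rightarrow> ('i \<Rightarrow> real) set" where
  "coord_space I = {v. \<forall>i. i \<notin> I \<longrightarrow> v i = 0}"

text \<open>
  That \<open>t \<mapsto> p (v + t e)\<close> has only real zeros refers to all complex zeros of this
  univariate polynomial, so \<open>t\<close> ranges over the complex numbers.
\<close>

definition hyperbolic :: "'i set \<Rightarrow> 'i rpoly \<Rightarrow> ('i \<Rightarrow> real) \<Rightarrow> bool" where
  "hyperbolic I p e \<longleftrightarrow>
     finite I \<and> pvars p \<subseteq> I \<and> homogeneous p \<and> e \<in> coord_space I \<and>
     peval e p > 0 \<and>
     (\<forall>v\<in>coord_space I. \<forall>t::complex.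
        peval (\<lambda>i. of_real (v i) + t * of_real (e i)) p = 0 \<longrightarrow> t \<in> \<real>)"


section \<open>Simple graphs\<close>

definition simple_graph :: "'v set \<Rightarrow> 'v set set \<Rightarrow> bool" where
  "simple_graph V E \<longleftrightarrow> finite V \<and> (\<forall>e\<in>E. e \<subseteq> V \<and> card e = 2)"

text \<open>The empty set is a clique, so the graph without vertices has clique number 0.\<close>

definition clique_number :: "'v set \<Rightarrow> 'v set set \<Rightarrow> nat" where
  "clique_number V E = Max (card ` {C. C \<subseteq> V \<and> clique C E})"


section \<open>The cubic form of a graph\<close>

datatype 'v coord = X0 | X 'v | Y "'v set"

definition graph_coords :: "'v set \<Rightarrow> 'v set set \<Rightarrow> 'v coord set" where
  "graph_coords V E = {X0} \<union> X ` V \<union> Y ` E"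

definition e0 :: "'v coord \<Rightarrow> real" where
  "e0 c = (if c = X0 then 1 else 0)"

definition q_form :: "'v set set \<Rightarrow> 'v coord rpoly" where
  "q_form E = (\<Sum>e\<in>E. (\<Prod>i\<in>e. pvar (X i)) * pvar (Y e))"

definition p_form :: "'v set \<Rightarrow> 'v set set \<Rightarrow> nat \<Rightarrow> 'v coord rpoly" where
  "p_form V E k =
     pconst (2 * real k / (real k - 1)) * pvar X0 ^ 3
     - pvar X0 * ((\<Sum>i\<in>V. pvar (X i) ^ 2) + (\<Sum>e\<in>E. pvar (Y e) ^ 2))
     + q_form E"

end

theory Submission
  imports Defs "HOL-Analysis.Convex"
begin

text \<open>
  Put \<open>c = 2 k / (k - 1)\<close>, \<open>s = \<parallel>x\<parallel>\<^sup>2 + \<parallel>y\<parallel>\<^sup>2\<close> and let \<open>q\<close> be the value of the graph form at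
  \<open>(x, y)\<close>. Restricted to a line in direction \<open>e0\<close> the cubic form is, up to a real shift of \<open>t\<close>, the
  depressed cubic \<open>c t\<^sup>3 - s t + q\<close>, and its zeros are all real iff its discriminant is nonnegative,
  that is, iff \<open>27 c q\<^sup>2 \<le> 4 s\<^sup>3\<close> (\<open>depressed_cubic_real_zeros_iff\<close>). So hyperbolicity amounts to
  this inequality for all \<open>x\<close> and \<open>y\<close> (\<open>hyperbolic_p_form_iff\<close>).

  If all cliques have at most \<open>k\<close> vertices, the Cauchy--Schwarz inequality gives
  \<open>q\<^sup>2 \<le> (\<Sum>\<^bsub>{i,j} \<in> E\<^esub> x\<^sub>i\<^sup>2 x\<^sub>j\<^sup>2) \<parallel>y\<parallel>\<^sup>2\<close>, and the Motzkin--Straus inequality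
  (\<open>Motzkin_Straus\<close>) bounds the first factor by \<open>(1 - 1/k) \<parallel>x\<parallel>\<^sup>4 / 2 = \<parallel>x\<parallel>\<^sup>4 / c\<close>. The required
  inequality then is the arithmetic-geometric mean inequality
  \<open>27 a\<^sup>2 b \<le> 4 (a + b)\<^sup>3\<close> for \<open>a = \<parallel>x\<parallel>\<^sup>2\<close> and \<open>b = \<parallel>y\<parallel>\<^sup>2\<close> (\<open>graph_cubic_bound\<close>).

  Conversely, for a clique with \<open>m \<ge> 2\<close> vertices all these estimates, with \<open>m\<close> in place of \<open>k\<close>, are
  equalities at the point with \<open>x\<^sub>i = 1\<close> on its vertices and \<open>y\<^sub>e = 1 / sqrt (m - 1)\<close> on its edges;
  there the inequality says exactly that \<open>m \<le> k\<close> (\<open>clique_card_bound\<close>).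
\<close>


section \<open>Evaluation of polynomials\<close>

text \<open>The value of the monomial with exponent map \<open>m\<close> at the point \<open>f\<close>.\<close>

definition meval :: "('i \<Rightarrow> 'b) \<Rightarrow> ('i \<Rightarrow>\<^sub>0 nat) \<Rightarrow> 'b::real_field" where
  "meval f m = (\<Prod>i\<in>Poly_Mapping.keys m. f i ^ Poly_Mapping.lookup m i)"

lemma meval_superset:
  assumes "finite S" "Poly_Mapping.keys m \<subseteq> S"
  shows "meval f m = (\<Prod>i\<in>S. f i ^ Poly_Mapping.lookup m i)"
  unfolding meval_def
  by (rule prod.mono_neutral_left) (use assms in \<open>auto simp: in_keys_iff\<close>)

lemma meval_add: "meval f (m + n) = meval f m * meval f n"
proof -
  define S where "S = Poly_Mapping.keys m \<union> Poly_Mapping.keys n"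
  have "finite S" "Poly_Mapping.keys m \<subseteq> S" "Poly_Mapping.keys n \<subseteq> S"
    "Poly_Mapping.keys (m + n) \<subseteq> S"
    using keys_add[of m n] by (auto simp: S_def)
  then show ?thesis
    by (simp add: meval_superset[where S = S] lookup_add power_add prod.distrib)
qed

lemma peval_superset:
  assumes "finite S" "Poly_Mapping.keys p \<subseteq> S"
  shows "peval f p = (\<Sum>m\<in>S. of_real (Poly_Mapping.lookup p m) * meval f m)"
  unfolding peval_def meval_def
  by (rule sum.mono_neutral_left) (use assms in \<open>auto simp: in_keys_iff\<close>)

lemma peval_zero [simp]: "peval f 0 = 0"
  by (simp add: peval_def)

lemma peval_single: "peval f (Poly_Mapping.single m c) = of_real c * meval f m"
  by (subst peval_superset[where S = "{m}"]) auto

lemma peval_one [simp]: "peval f 1 = 1"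
  by (simp flip: single_one add: peval_single meval_def)

lemma peval_pconst [simp]: "peval f (pconst c) = of_real c"
  by (simp add: pconst_def peval_single meval_def)

lemma peval_pvar [simp]: "peval f (pvar i) = f i"
  by (simp add: pvar_def peval_single meval_def)

lemma peval_add [simp]: "peval f (p + q) = peval f p + peval f q"
proof -
  define S where "S = Poly_Mapping.keys p \<union> Poly_Mapping.keys q"
  have "finite S" "Poly_Mapping.keys p \<subseteq> S" "Poly_Mapping.keys q \<subseteq> S"
    "Poly_Mapping.keys (p + q) \<subseteq> S"
    using keys_add[of p q] by (auto simp: S_def)
  then show ?thesis
    by (simp add: peval_superset[where S = S] lookup_add distrib_right sum.distrib)
qed

lemma peval_diff [simp]: "peval f (p - q) = peval f p - peval f q"
  using peval_add[of f "p - q" q] by simp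

lemma peval_sum [simp]: "peval f (\<Sum>a\<in>A. p a) = (\<Sum>a\<in>A. peval f (p a))"
  by (induction A rule: infinite_finite_induct) auto

lemma sum_single_keys:
  "p = (\<Sum>m\<in>Poly_Mapping.keys p. Poly_Mapping.single m (Poly_Mapping.lookup p m))"
proof (rule poly_mapping_eqI)
  fix n
  show "Poly_Mapping.lookup p n = Poly_Mapping.lookup
    (\<Sum>m\<in>Poly_Mapping.keys p. Poly_Mapping.single m (Poly_Mapping.lookup p m)) n"
    by (simp add: lookup_sum lookup_single when_def sum.delta' in_keys_iff)
qed

lemma peval_mult [simp]: "peval f (p * q) = peval f p * peval f q"
proof -
  have "peval f (p * q) = peval f
      ((\<Sum>m\<in>Poly_Mapping.keys p. Poly_Mapping.single m (Poly_Mapping.lookup p m)) *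
       (\<Sum>n\<in>Poly_Mapping.keys q. Poly_Mapping.single n (Poly_Mapping.lookup q n)))"
    by (simp only: sum_single_keys[symmetric])
  also have "\<dots> = (\<Sum>m\<in>Poly_Mapping.keys p. \<Sum>n\<in>Poly_Mapping.keys q.
      (of_real (Poly_Mapping.lookup p m) * meval f m) *
      (of_real (Poly_Mapping.lookup q n) * meval f n))"
    by (simp add: sum_product mult_single peval_single meval_add mult_ac)
  also have "\<dots> = peval f p * peval f q"
    by (simp add: sum_product peval_superset[OF finite_keys order_refl])
  finally show ?thesis .
qed

lemma peval_power [simp]: "peval f (p ^ n) = peval f p ^ n"
  by (induction n) auto

lemma peval_prod [simp]: "peval f (\<Prod>a\<in>A. p a) = (\<Prod>a\<in>A. peval f (p a))"
  by (induction A rule: infinite_finite_induct) auto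


section \<open>Forms of a given degree\<close>

text \<open>The forms of degree \<open>d\<close> in variables from \<open>I\<close>; the zero polynomial is one for every \<open>d\<close>.\<close>

definition forms :: "'i set \<Rightarrow> nat \<Rightarrow> 'i rpoly set" where
  "forms I d = {p. \<forall>m\<in>Poly_Mapping.keys p. Poly_Mapping.keys m \<subseteq> I \<and> monom_degree m = d}"

lemma forms_pvars: "p \<in> forms I d \<Longrightarrow> pvars p \<subseteq> I"
  and forms_homogeneous: "p \<in> forms I d \<Longrightarrow> homogeneous p"
  by (auto simp: forms_def pvars_def homogeneous_def)

lemma monom_degree_add: "monom_degree (m + n) = monom_degree m + monom_degree n"
proof -
  define S where "S = Poly_Mapping.keys m \<union> Poly_Mapping.keys n"
  have deg: "monom_degree l = (\<Sum>i\<in>S. Poly_Mapping.lookup l i)"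
    if "Poly_Mapping.keys l \<subseteq> S" for l
    unfolding monom_degree_def
    by (rule sum.mono_neutral_left) (use that in \<open>auto simp: S_def in_keys_iff\<close>)
  have "Poly_Mapping.keys (m + n) \<subseteq> S"
    using keys_add[of m n] by (auto simp: S_def)
  then show ?thesis
    using deg[of m] deg[of n] deg[of "m + n"] by (simp add: S_def lookup_add sum.distrib)
qed

lemma forms_pconst: "pconst c \<in> forms I 0"
  by (auto simp: forms_def pconst_def monom_degree_def split: if_splits)

lemma forms_zero: "0 \<in> forms I d"
  by (simp add: forms_def)

lemma forms_one: "1 \<in> forms I 0"
  using forms_pconst[of 1 I] by (simp add: pconst_def)

lemma forms_pvar: "i \<in> I \<Longrightarrow> pvar i \<in> forms I 1"
  by (auto simp: forms_def pvar_def monom_degree_def split: if_splits)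

lemma forms_add: "p \<in> forms I d \<Longrightarrow> q \<in> forms I d \<Longrightarrow> p + q \<in> forms I d"
  using keys_add[of p q] by (fastforce simp: forms_def)

lemma forms_diff: "p \<in> forms I d \<Longrightarrow> q \<in> forms I d \<Longrightarrow> p - q \<in> forms I d"
proof -
  have "Poly_Mapping.keys (p - q) \<subseteq> Poly_Mapping.keys p \<union> Poly_Mapping.keys q"
    by (auto simp: in_keys_iff lookup_minus)
  then show "p \<in> forms I d \<Longrightarrow> q \<in> forms I d \<Longrightarrow> p - q \<in> forms I d"
    unfolding forms_def by blast
qed

lemma forms_mult:
  assumes "p \<in> forms I d" "q \<in> forms I d'"
  shows "p * q \<in> forms I (d + d')"
  unfolding forms_def
proof (intro CollectI ballI)
  fix l assume "l \<in> Poly_Mapping.keys (p * q)"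
  then obtain m n where mn: "l = m + n" "m \<in> Poly_Mapping.keys p" "n \<in> Poly_Mapping.keys q"
    using keys_mult[of p q] by blast
  with assms show "Poly_Mapping.keys l \<subseteq> I \<and> monom_degree l = d + d'"
    using keys_add[of m n] by (fastforce simp: forms_def monom_degree_add)
qed

lemma forms_power: "p \<in> forms I d \<Longrightarrow> p ^ n \<in> forms I (n * d)"
  by (induction n) (auto intro: forms_one forms_mult)

lemma forms_sum: "(\<And>a. a \<in> A \<Longrightarrow> p a \<in> forms I d) \<Longrightarrow> (\<Sum>a\<in>A. p a) \<in> forms I d"
  by (induction A rule: infinite_finite_induct) (auto intro: forms_zero forms_add)

lemma forms_prod:
  "finite A \<Longrightarrow> (\<And>a. a \<in> A \<Longrightarrow> p a \<in> forms I d) \<Longrightarrow> (\<Prod>a\<in>A. p a) \<in> forms I (card A * d)"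
  by (induction A rule: finite_induct) (auto intro: forms_one forms_mult)


section \<open>Cubics with only real zeros\<close>

text \<open>
  A nonreal zero \<open>a + i b\<close> determines \<open>s\<close> and \<open>q\<close> in terms of \<open>a\<close> and \<open>b\<close>, and makes the
  discriminant negative. If conversely the discriminant is negative and \<open>q < 0\<close>, the value at the
  larger critical point \<open>sqrt (s / (3 c))\<close> and even at its double \<open>r\<^sub>0\<close> is negative, so there is a
  real zero \<open>r > r\<^sub>0\<close>; the quadratic factor left after dividing by \<open>t - r\<close> has no real zero. The
  case \<open>q > 0\<close> follows by replacing \<open>t\<close> by \<open>- t\<close>.
\<close>

lemma depressed_cubic_real_zeros_iff:
  fixes c s q :: real
  assumes "c > 0" "s \<ge> 0"
  shows "(\<forall>t::complex. of_real c * t ^ 3 - of_real s * t + of_real q = 0 \<longrightarrow> t \<in> \<real>)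
    \<longleftrightarrow> 27 * c * q\<^sup>2 \<le> 4 * s ^ 3"
proof -
  let ?P = "\<lambda>q (t::complex). of_real c * t ^ 3 - of_real s * t + of_real q = 0"
  have real: "t \<in> \<real>" if le: "27 * c * q\<^sup>2 \<le> 4 * s ^ 3" and t: "?P q t" for t q
  proof (rule ccontr)
    assume "t \<notin> \<real>"
    define a b where "a = Re t" and "b = Im t"
    have b: "b \<noteq> 0"
      using \<open>t \<notin> \<real>\<close> by (simp add: b_def complex_is_Real_iff)
    have re: "c * (a^3 - 3*a*b^2) - s*a + q = 0" and im: "c * (3*a^2*b - b^3) - s*b = 0"
      using arg_cong[OF t, of Re] arg_cong[OF t, of Im]
      by (simp_all add: a_def b_def power3_eq_cube power2_eq_square algebra_simps)
    have "b * (c * (3*a^2 - b^2) - s) = 0"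
      using im by (simp add: power3_eq_cube power2_eq_square algebra_simps)
    with b have s: "s = c * (3*a^2 - b^2)" by simp
    have q: "q = 2 * c * a * (a^2 + b^2)"
      using re unfolding s by (simp add: power3_eq_cube power2_eq_square algebra_simps)
    have "4 * s^3 - 27 * c * q^2 = - (4 * c^3 * b^2 * (9*a^2 + b^2)^2)"
      unfolding s q by algebra
    moreover have "4 * c^3 * b^2 * (9*a^2 + b^2)^2 > 0"
      using b \<open>c > 0\<close> by (intro mult_pos_pos zero_less_power[of "9*a^2 + b^2"] add_nonneg_pos) auto
    ultimately show False using le by linarith
  qed
  have nonreal: "\<exists>t. ?P q t \<and> t \<notin> \<real>" if less: "4 * s ^ 3 < 27 * c * q\<^sup>2" and q: "q < 0" for q
  proof -
    define r0 where "r0 = 2 * sqrt (s / (3 * c))"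
    have r0: "r0 \<ge> 0" "3 * c * r0\<^sup>2 = 4 * s"
      using assms by (simp_all add: r0_def power_mult_distrib)
    let ?f = "\<lambda>r. c * r ^ 3 - s * r + q"
    have f0: "?f r0 < 0"
    proof -
      define w where "w = c * r0 ^ 3 - s * r0"
      have w: "3 * w = s * r0"
        using r0(2) unfolding w_def by algebra
      have "27 * c * w\<^sup>2 = 3 * c * (3 * w)\<^sup>2"
        by (simp add: power_mult_distrib)
      also have "\<dots> = s\<^sup>2 * (3 * c * r0\<^sup>2)"
        unfolding w by (simp add: power_mult_distrib)
      also have "\<dots> = 4 * s ^ 3"
        unfolding r0(2) by (simp add: power3_eq_cube power2_eq_square)
      finally have "27 * c * w\<^sup>2 = 4 * s ^ 3" .
      with less \<open>c > 0\<close> have "w\<^sup>2 < (- q)\<^sup>2"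
          using mult_less_cancel_left_pos[of "27 * c" "w\<^sup>2" "q\<^sup>2"] by simp
      with q have "w < - q" by (intro power2_less_imp_less[of w "- q"]) auto
      then show ?thesis by (simp add: w_def)
    qed
    \<comment> \<open>A point beyond \<open>r0\<close> at which the cubic is nonnegative.\<close>
    define R where "R = r0 + 1 + (s - q) / c"
    have R: "r0 \<le> R" "R \<ge> 1" using assms q r0 by (auto simp: R_def)
    have "c * R = c * (r0 + 1) + (s - q)"
      using \<open>c > 0\<close> by (simp add: R_def distrib_left)
    then have "s - q \<le> c * R" using r0(1) \<open>c > 0\<close> by simp
    have "s * R - q \<le> (s - q) * R"
      using mult_left_mono[of 1 R "- q"] R q by (simp add: left_diff_distrib)
    also have "\<dots> \<le> c * R * R" using \<open>s - q \<le> c * R\<close> R by (intro mult_right_mono) auto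
    also have "\<dots> \<le> c * R * R * R"
      using mult_left_mono[of 1 R "c * R * R"] R assms by simp
    finally have "?f R \<ge> 0" by (simp add: power3_eq_cube algebra_simps)
    then obtain r where r: "r0 \<le> r" "?f r = 0"
      using IVT'[of ?f r0 0 R] f0 R by (force intro!: continuous_intros)
    with f0 have "r0 < r" by (cases "r = r0") auto
    with r0 have "r0\<^sup>2 < r\<^sup>2" by (simp add: power_strict_mono)
    with \<open>c > 0\<close> have "3 * c * r0\<^sup>2 < 3 * c * r\<^sup>2" by simp
    with r0(2) have D: "3 * c * r\<^sup>2 - 4 * s > 0" by simp
    \<comment> \<open>The zeros other than \<open>r\<close> are \<open>- r / 2 + i b\<close> and \<open>- r / 2 - i b\<close>.\<close>
    define b where "b = sqrt ((3 * c * r\<^sup>2 - 4 * s) / (4 * c))"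
    have b: "b > 0" "4 * c * b\<^sup>2 = 3 * c * r\<^sup>2 - 4 * s"
      using D assms by (simp_all add: b_def)
    have "?P q (Complex (- r / 2) b)"
    proof (rule complex_eqI)
      have "c * ((-r/2)^3 - 3*(-r/2)*b^2) - s*(-r/2) + q = 0"
        using b(2) r(2) by algebra
      then show "Re (of_real c * Complex (- r / 2) b ^ 3 - of_real s * Complex (- r / 2) b + of_real q) = Re 0"
        by (simp add: power3_eq_cube power2_eq_square algebra_simps)
      have "c * (3*(-r/2)^2*b - b^3) - s*b = 0"
        using b(2) by algebra
      then show "Im (of_real c * Complex (- r / 2) b ^ 3 - of_real s * Complex (- r / 2) b + of_real q) = Im 0"
        by (simp add: power3_eq_cube power2_eq_square algebra_simps)
    qed
    then show ?thesis using b by (intro exI[of _ "Complex (- r / 2) b"]) (simp add: complex_is_Real_iff)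
  qed
  show ?thesis
  proof
    assume all: "\<forall>t. ?P q t \<longrightarrow> t \<in> \<real>"
    show "27 * c * q\<^sup>2 \<le> 4 * s ^ 3"
    proof (rule ccontr)
      assume "\<not> ?thesis"
      then have less: "4 * s ^ 3 < 27 * c * q\<^sup>2" by simp
      then have "q \<noteq> 0" using assms by auto
      have "\<exists>t. ?P (- \<bar>q\<bar>) t \<and> t \<notin> \<real>"
        using nonreal[of "- \<bar>q\<bar>"] less \<open>q \<noteq> 0\<close> by simp
      then obtain t where t: "?P (- \<bar>q\<bar>) t" "t \<notin> \<real>" by blast
      show False
      proof (cases "q < 0")
        case True
        with t all show ?thesis by auto
      next
        case False
        have "?P q (- t)"
          using arg_cong[OF t(1), of uminus] False by (simp add: power3_eq_cube)
        with all t(2) show ?thesis by (metis Reals_minus_iff)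
      qed
    qed
  next
    assume "27 * c * q\<^sup>2 \<le> 4 * s ^ 3"
    then show "\<forall>t. ?P q t \<longrightarrow> t \<in> \<real>" using real by blast
  qed
qed


section \<open>The Motzkin--Straus inequality\<close>

text \<open>The sum of \<open>u\<^sub>i u\<^sub>j\<close> over the edges \<open>{i, j}\<close> with both ends in \<open>S\<close>, each edge counted once.\<close>

definition edge_sum :: "'v set set \<Rightarrow> 'v set \<Rightarrow> ('v \<Rightarrow> real) \<Rightarrow> real" where
  "edge_sum E S u = (\<Sum>e | e \<in> E \<and> e \<subseteq> S. \<Prod>i\<in>e. u i)"

lemma edge_sum_cong: "(\<And>i. i \<in> S \<Longrightarrow> u i = w i) \<Longrightarrow> edge_sum E S u = edge_sum E S w"
  unfolding edge_sum_def by (intro sum.cong prod.cong) auto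

lemma edge_sum_insert:
  assumes E: "\<forall>e\<in>E. card e = 2" and "finite S" "a \<notin> S"
  shows "edge_sum E (insert a S) u = edge_sum E S u + u a * (\<Sum>j | j \<in> S \<and> {a, j} \<in> E. u j)"
proof -
  let ?N = "{j. j \<in> S \<and> {a, j} \<in> E}"
  have split: "{e. e \<in> E \<and> e \<subseteq> insert a S} = {e. e \<in> E \<and> e \<subseteq> S} \<union> (\<lambda>j. {a, j}) ` ?N"
  proof (intro equalityI subsetI)
    fix e assume e: "e \<in> {e. e \<in> E \<and> e \<subseteq> insert a S}"
    show "e \<in> {e. e \<in> E \<and> e \<subseteq> S} \<union> (\<lambda>j. {a, j}) ` ?N"
    proof (cases "a \<in> e")
      case True
      from e E have "card e = 2" by auto
      with True obtain j where "e = {a, j}" "j \<noteq> a"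
        by (auto simp: card_2_iff)
      with e show ?thesis by auto
    qed (use e in auto)
  qed auto
  have "edge_sum E (insert a S) u =
      edge_sum E S u + (\<Sum>e\<in>(\<lambda>j. {a, j}) ` ?N. \<Prod>i\<in>e. u i)"
    unfolding edge_sum_def split
  proof (rule sum.union_disjoint)
    show "finite {e. e \<in> E \<and> e \<subseteq> S}"
      by (rule finite_subset[of _ "Pow S"]) (use assms in auto)
  qed (use assms in auto)
  also have "(\<Sum>e\<in>(\<lambda>j. {a, j}) ` ?N. \<Prod>i\<in>e. u i) = (\<Sum>j\<in>?N. \<Prod>i\<in>{a, j}. u i)"
    by (rule sum.reindex_cong[where l = "\<lambda>j. {a, j}"]) (auto simp: inj_on_def doubleton_eq_iff)
  also have "\<dots> = (\<Sum>j\<in>?N. u a * u j)"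
    using \<open>a \<notin> S\<close> by (intro sum.cong refl prod.insert[THEN trans]) auto
  finally show ?thesis by (simp add: sum_distrib_left)
qed

text \<open>In a clique any two different vertices contribute the product of their weights.\<close>

lemma edge_sum_clique:
  assumes E: "\<forall>e\<in>E. card e = 2" and "finite S" "clique S E"
  shows "2 * edge_sum E S u = (\<Sum>i\<in>S. u i)\<^sup>2 - (\<Sum>i\<in>S. (u i)\<^sup>2)"
  using assms(2,3)
proof (induction S rule: finite_induct)
  case empty
  have "{e. e \<in> E \<and> e \<subseteq> {}} = {}"
    using E by force
  then show ?case by (simp only: edge_sum_def) simp
next
  case (insert a S)
  have "clique S E" "{j. j \<in> S \<and> {a, j} \<in> E} = S"
    using insert.prems insert.hyps by (auto simp: clique_def)
  then show ?case
    using insert edge_sum_insert[OF E insert.hyps(1,2), of u]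
    by (simp add: power2_eq_square algebra_simps)
qed

text \<open>
  As long as \<open>S\<close> contains two nonadjacent vertices \<open>a\<close> and \<open>b\<close>, the edge sum is linear in the
  amount of weight moved from \<open>b\<close> to \<open>a\<close>, so all the weight of one of them can be moved to the
  other without decreasing the edge sum, and the vertex left without weight can be dropped.
  Once \<open>S\<close> is a clique, the bound is the Cauchy--Schwarz inequality.
\<close>

theorem Motzkin_Straus:
  fixes u :: "'v \<Rightarrow> real"
  assumes E: "\<forall>e\<in>E. card e = 2" and "finite S"
    and "\<forall>C\<subseteq>S. clique C E \<longrightarrow> card C \<le> k" and "\<forall>i\<in>S. u i \<ge> 0"
  shows "2 * real k * edge_sum E S u \<le> (real k - 1) * (\<Sum>i\<in>S. u i)\<^sup>2"
  using assms(2-)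
proof (induction S arbitrary: u rule: finite_psubset_induct)
  case (psubset S)
  show ?case
  proof (cases "clique S E")
    case True
    have "(\<Sum>i\<in>S. u i)\<^sup>2 \<le> (\<Sum>i\<in>S. (u i)\<^sup>2) * real (card S)"
      by (rule sum_squared_le_sum_of_squares)
    also have "\<dots> \<le> (\<Sum>i\<in>S. (u i)\<^sup>2) * real k"
      using True psubset.prems(1) by (intro mult_left_mono) (auto intro: sum_nonneg)
    finally have "(\<Sum>i\<in>S. u i)\<^sup>2 \<le> real k * (\<Sum>i\<in>S. (u i)\<^sup>2)"
      by (simp add: mult.commute)
    moreover have "2 * real k * edge_sum E S u =
        real k * ((\<Sum>i\<in>S. u i)\<^sup>2 - (\<Sum>i\<in>S. (u i)\<^sup>2))"
      using edge_sum_clique[OF E psubset.hyps(1) True, of u] by simp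
    ultimately show ?thesis by (simp add: algebra_simps)
  next
    case False
    \<comment> \<open>\<open>N x T\<close> is the rate at which the edge sum grows with the weight of \<open>x\<close>.\<close>
    define N where "N x T = (\<Sum>j | j \<in> T \<and> {x, j} \<in> E. u j)" for x T
    have shift: ?thesis
      if ab: "a \<in> S" "b \<in> S" "a \<noteq> b" "{a, b} \<notin> E"
        and le: "N b (S - {a, b}) \<le> N a (S - {a, b})" for a b
    proof -
      define T where "T = S - {a, b}"
      have T: "finite T" "a \<notin> T" "b \<notin> insert a T" and S: "S = insert b (insert a T)"
        using ab psubset.hyps by (auto simp: T_def)
      then have "finite (insert a T)" by simp
      define w where "w = u(a := u a + u b)"
      have nb: "{j. j \<in> insert a T \<and> {b, j} \<in> E} = {j. j \<in> T \<and> {b, j} \<in> E}"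
        using ab by (auto simp: insert_commute)
      have "edge_sum E S u = edge_sum E T u + u a * N a T + u b * N b T"
        unfolding S edge_sum_insert[OF E \<open>finite (insert a T)\<close> T(3)] edge_sum_insert[OF E T(1,2)] nb N_def
        by simp
      also have "\<dots> \<le> edge_sum E T u + u a * N a T + u b * N a T"
        using le psubset.prems(2) ab by (simp add: T_def mult_left_mono)
      also have "\<dots> = edge_sum E (insert a T) w"
      proof -
        have "edge_sum E T w = edge_sum E T u"
          using T by (intro edge_sum_cong) (auto simp: w_def)
        moreover have "(\<Sum>j | j \<in> T \<and> {a, j} \<in> E. w j) = N a T"
          unfolding N_def using T by (intro sum.cong) (auto simp: w_def)
        ultimately show ?thesis
          using T by (simp add: edge_sum_insert[OF E] w_def algebra_simps)
      qed
      finally have "2 * real k * edge_sum E S u \<le> 2 * real k * edge_sum E (insert a T) w"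
        by (simp add: mult_left_mono)
      also have "\<dots> \<le> (real k - 1) * (\<Sum>i\<in>insert a T. w i)\<^sup>2"
      proof (rule psubset.IH)
        show "\<forall>C\<subseteq>insert a T. clique C E \<longrightarrow> card C \<le> k"
          using psubset.prems(1) by (auto simp: S)
        show "\<forall>i\<in>insert a T. 0 \<le> w i"
          using psubset.prems(2) ab by (auto simp: w_def S)
      qed (use T in \<open>auto simp: S\<close>)
      also have "(\<Sum>i\<in>insert a T. w i) = (\<Sum>i\<in>S. u i)"
      proof -
        have "(\<Sum>i\<in>T. w i) = (\<Sum>i\<in>T. u i)"
          using T by (intro sum.cong) (auto simp: w_def)
        then show ?thesis using T by (simp add: S w_def)
      qed
      finally show ?thesis .
    qed
    from False obtain a b where ab: "a \<in> S" "b \<in> S" "a \<noteq> b" "{a, b} \<notin> E"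
      by (auto simp: clique_def)
    show ?thesis
    proof (cases "N b (S - {a, b}) \<le> N a (S - {a, b})")
      case True
      with ab show ?thesis by (rule shift)
    next
      case False
      with ab show ?thesis by (intro shift[of b a]) (auto simp: insert_commute)
    qed
  qed
qed


section \<open>Hyperbolicity\<close>

lemma simple_graphD:
  assumes "simple_graph V E"
  shows "finite V" "finite E" "\<forall>e\<in>E. card e = 2" "\<And>e. e \<in> E \<Longrightarrow> finite e \<and> e \<subseteq> V"
proof -
  show V: "finite V" and sub: "\<And>e. e \<in> E \<Longrightarrow> finite e \<and> e \<subseteq> V" and "\<forall>e\<in>E. card e = 2"
    using assms by (auto simp: simple_graph_def intro: finite_subset)
  show "finite E"
    using V sub by (intro finite_subset[of E "Pow V"]) auto
qed

lemma p_form_forms: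
  assumes "simple_graph V E"
  shows "p_form V E k \<in> forms (graph_coords V E) 3"
proof -
  note G = simple_graphD[OF assms]
  let ?I = "graph_coords V E"
  have X0: "pvar X0 \<in> forms ?I 1" and X: "\<And>i. i \<in> V \<Longrightarrow> pvar (X i) \<in> forms ?I 1"
    and Y: "\<And>e. e \<in> E \<Longrightarrow> pvar (Y e) \<in> forms ?I 1"
    by (rule forms_pvar, simp add: graph_coords_def)+
  have cube: "pconst c * pvar X0 ^ 3 \<in> forms ?I 3" for c
    using forms_mult[OF forms_pconst forms_power[OF X0, of 3]] by simp
  have squares: "(\<Sum>i\<in>V. pvar (X i) ^ 2) + (\<Sum>e\<in>E. pvar (Y e) ^ 2) \<in> forms ?I 2"
    using forms_power[OF X, of _ 2] forms_power[OF Y, of _ 2]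
    by (intro forms_add forms_sum) auto
  have "pvar X0 * ((\<Sum>i\<in>V. pvar (X i) ^ 2) + (\<Sum>e\<in>E. pvar (Y e) ^ 2)) \<in> forms ?I 3"
    using forms_mult[OF X0 squares] by (simp add: eval_nat_numeral)
  moreover have "q_form E \<in> forms ?I 3"
    unfolding q_form_def
  proof (rule forms_sum)
    fix e assume e: "e \<in> E"
    have "(\<Prod>i\<in>e. pvar (X i)) \<in> forms ?I (card e * 1)"
      by (rule forms_prod) (use G(4)[OF e] X in auto)
    from forms_mult[OF this Y[OF e]] show "(\<Prod>i\<in>e. pvar (X i)) * pvar (Y e) \<in> forms ?I 3"
      using G(3) e by simp
  qed
  ultimately show ?thesis
    unfolding p_form_def using cube by (intro forms_add forms_diff)
qed

lemma peval_p_form: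
  fixes f :: "'v coord \<Rightarrow> 'b::real_field"
  shows "peval f (p_form V E k) = of_real (2 * real k / (real k - 1)) * f X0 ^ 3
     - f X0 * ((\<Sum>i\<in>V. f (X i) ^ 2) + (\<Sum>e\<in>E. f (Y e) ^ 2))
     + (\<Sum>e\<in>E. (\<Prod>i\<in>e. f (X i)) * f (Y e))"
  by (simp only: p_form_def q_form_def peval_add peval_diff peval_mult peval_power peval_sum
      peval_prod peval_pvar peval_pconst)

text \<open>
  The coordinate of \<open>v\<close> at \<open>X0\<close> only shifts \<open>t\<close> by a real number, so only \<open>x\<close> and \<open>y\<close> matter; their
  values outside the vertices and edges are irrelevant.
\<close>

lemma hyperbolic_p_form_iff:
  assumes G: "simple_graph V E" and k: "k \<ge> 2"
  shows "hyperbolic (graph_coords V E) (p_form V E k) e0 \<longleftrightarrow>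
    (\<forall>x y. 27 * (2 * real k / (real k - 1)) * (\<Sum>e\<in>E. (\<Prod>i\<in>e. x i) * y e)\<^sup>2
       \<le> 4 * ((\<Sum>i\<in>V. (x i)\<^sup>2) + (\<Sum>e\<in>E. (y e)\<^sup>2)) ^ 3)"
proof -
  define c where "c = 2 * real k / (real k - 1)"
  have c: "c > 0" using k by (simp add: c_def)
  define s where "s x y = (\<Sum>i\<in>V. (x i)\<^sup>2) + (\<Sum>e\<in>E. (y e)\<^sup>2)"
    for x :: "'a \<Rightarrow> real" and y :: "'a set \<Rightarrow> real"
  define q where "q x y = (\<Sum>e\<in>E. (\<Prod>i\<in>e. x i) * y e)"
    for x :: "'a \<Rightarrow> real" and y :: "'a set \<Rightarrow> real"
  have s: "s x y \<ge> 0" for x y by (simp add: s_def sum_nonneg)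
  define cubic where "cubic x y t = of_real c * t ^ 3 - of_real (s x y) * t + of_real (q x y)"
    for x y and t :: complex
  have eval: "peval (\<lambda>i. of_real (v i) + t * of_real (e0 i)) (p_form V E k) =
      cubic (\<lambda>i. v (X i)) (\<lambda>e. v (Y e)) (of_real (v X0) + t)" for v and t :: complex
    by (simp add: peval_p_form e0_def cubic_def s_def q_def c_def del: of_real_divide)
  let ?I = "graph_coords V E"
  have form: "p_form V E k \<in> forms ?I 3" by (rule p_form_forms[OF G])
  have "finite ?I" "e0 \<in> coord_space ?I"
    using simple_graphD[OF G] by (auto simp: graph_coords_def coord_space_def e0_def)
  moreover have "peval e0 (p_form V E k) = c"
  proof -
    have "(\<Prod>i\<in>e. e0 (X i)) * e0 (Y e) = 0" for e :: "'a set" by (simp add: e0_def)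
    then show ?thesis by (simp add: peval_p_form e0_def c_def)
  qed
  ultimately have "hyperbolic ?I (p_form V E k) e0 \<longleftrightarrow>
      (\<forall>v\<in>coord_space ?I. \<forall>t.
        cubic (\<lambda>i. v (X i)) (\<lambda>e. v (Y e)) (of_real (v X0) + t) = 0 \<longrightarrow> t \<in> \<real>)"
    using c forms_pvars[OF form] forms_homogeneous[OF form] by (simp add: hyperbolic_def eval)
  also have "\<dots> \<longleftrightarrow> (\<forall>x y t. cubic x y t = 0 \<longrightarrow> t \<in> \<real>)"
  proof (intro iffI allI impI ballI)
    fix x y t
    assume hyp: "\<forall>v\<in>coord_space ?I. \<forall>t.
        cubic (\<lambda>i. v (X i)) (\<lambda>e. v (Y e)) (of_real (v X0) + t) = 0 \<longrightarrow> t \<in> \<real>"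
      and t: "cubic x y t = 0"
    define v where "v = (\<lambda>c. if c \<in> ?I then case c of X0 \<Rightarrow> 0 | X i \<Rightarrow> x i | Y e \<Rightarrow> y e else 0)"
    have v: "v \<in> coord_space ?I" "v X0 = 0" "\<And>i. i \<in> V \<Longrightarrow> v (X i) = x i"
      "\<And>e. e \<in> E \<Longrightarrow> v (Y e) = y e"
      by (auto simp: coord_space_def v_def graph_coords_def)
    have "s (\<lambda>i. v (X i)) (\<lambda>e. v (Y e)) = s x y"
      by (simp add: s_def v)
    moreover have "q (\<lambda>i. v (X i)) (\<lambda>e. v (Y e)) = q x y"
      unfolding q_def using simple_graphD(4)[OF G] v
      by (intro sum.cong refl arg_cong2[where f = "(*)"] prod.cong) auto
    ultimately show "t \<in> \<real>"
      using hyp v(1,2) t by (auto simp: cubic_def)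
  next
    fix v t
    assume hyp: "\<forall>x y t. cubic x y t = 0 \<longrightarrow> t \<in> \<real>"
      and "cubic (\<lambda>i. v (X i)) (\<lambda>e. v (Y e)) (of_real (v X0) + t) = 0"
    then have "of_real (v X0) + t \<in> \<real>" by blast
    then show "t \<in> \<real>" using Reals_diff[OF _ Reals_of_real[of "v X0"]] by fastforce
  qed
  also have "\<dots> \<longleftrightarrow> (\<forall>x y. 27 * c * (q x y)\<^sup>2 \<le> 4 * s x y ^ 3)"
    using depressed_cubic_real_zeros_iff[OF c s] unfolding cubic_def by blast
  finally show ?thesis by (simp add: c_def s_def q_def)
qed

lemma clique_number_le_iff:
  assumes "finite V"
  shows "clique_number V E \<le> k \<longleftrightarrow> (\<forall>C\<subseteq>V. clique C E \<longrightarrow> card C \<le> k)"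
proof -
  have "finite {C. C \<subseteq> V \<and> clique C E}" "{} \<in> {C. C \<subseteq> V \<and> clique C E}"
    using assms by auto
  then have "finite (card ` {C. C \<subseteq> V \<and> clique C E})" "card ` {C. C \<subseteq> V \<and> clique C E} \<noteq> {}"
    by blast+
  then show ?thesis
    unfolding clique_number_def by (subst Max_le_iff) auto
qed

lemma graph_cubic_bound:
  fixes x :: "'v \<Rightarrow> real" and y :: "'v set \<Rightarrow> real"
  assumes G: "simple_graph V E" and k: "k \<ge> 2"
    and "\<forall>C\<subseteq>V. clique C E \<longrightarrow> card C \<le> k"
  shows "27 * (2 * real k / (real k - 1)) * (\<Sum>e\<in>E. (\<Prod>i\<in>e. x i) * y e)\<^sup>2
       \<le> 4 * ((\<Sum>i\<in>V. (x i)\<^sup>2) + (\<Sum>e\<in>E. (y e)\<^sup>2)) ^ 3"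
proof -
  note simple = simple_graphD[OF G]
  define q where "q = (\<Sum>e\<in>E. (\<Prod>i\<in>e. x i) * y e)"
  define a b where "a = (\<Sum>i\<in>V. (x i)\<^sup>2)" and "b = (\<Sum>e\<in>E. (y e)\<^sup>2)"
  define L where "L = edge_sum E V (\<lambda>i. (x i)\<^sup>2)"
  have pos: "a \<ge> 0" "b \<ge> 0" by (simp_all add: a_def b_def sum_nonneg)
  have "{e. e \<in> E \<and> e \<subseteq> V} = E" using simple by auto
  then have "L = (\<Sum>e\<in>E. (\<Prod>i\<in>e. x i)\<^sup>2)"
    by (simp add: L_def edge_sum_def prod_power_distrib)
  then have "q\<^sup>2 \<le> L * b"
    unfolding q_def b_def by (simp add: Cauchy_Schwarz_ineq_sum)
  then have "2 * real k * q\<^sup>2 \<le> 2 * real k * L * b"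
    by (simp add: mult_left_mono mult.assoc)
  also have "\<dots> \<le> (real k - 1) * a\<^sup>2 * b"
    unfolding L_def a_def
    by (intro mult_right_mono Motzkin_Straus[OF simple(3,1) assms(3)] pos) auto
  finally have "(2 * real k / (real k - 1)) * q\<^sup>2 \<le> a\<^sup>2 * b"
    using k by (simp add: divide_simps mult_ac)
  moreover have "4 * (a + b) ^ 3 - 27 * (a\<^sup>2 * b) = (a - 2 * b)\<^sup>2 * (4 * a + b)"
    by algebra
  moreover have "(a - 2 * b)\<^sup>2 * (4 * a + b) \<ge> 0" using pos by simp
  ultimately show ?thesis unfolding q_def[symmetric] a_def[symmetric] b_def[symmetric] by linarith
qed

text \<open>The inequality is needed only at one point, which is supported on the clique and its edges.\<close>

lemma clique_card_bound:
  assumes G: "simple_graph V E" and k: "k \<ge> 2"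
    and C: "C \<subseteq> V" "clique C E"
    and bound: "\<And>x y. 27 * (2 * real k / (real k - 1)) * (\<Sum>e\<in>E. (\<Prod>i\<in>e. x i) * y e)\<^sup>2
       \<le> 4 * ((\<Sum>i\<in>V. (x i)\<^sup>2) + (\<Sum>e\<in>E. (y e)\<^sup>2)) ^ 3"
  shows "card C \<le> k"
proof (cases "card C \<ge> 2")
  case False
  with k show ?thesis by simp
next
  case True
  note simple = simple_graphD[OF G]
  define m where "m = real (card C)"
  have m: "m \<ge> 2" using True by (simp add: m_def)
  define F where "F = {e. e \<in> E \<and> e \<subseteq> C}"
  have F: "F \<subseteq> E" by (auto simp: F_def)
  \<comment> \<open>This value makes \<open>\<parallel>x\<parallel>\<^sup>2 = 2 \<parallel>y\<parallel>\<^sup>2\<close>, the equality case of \<open>27 a\<^sup>2 b \<le> 4 (a + b)\<^sup>3\<close>.\<close>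
  define \<beta> where "\<beta> = 1 / sqrt (m - 1)"
  have \<beta>: "\<beta>\<^sup>2 * (m - 1) = 1" using m by (simp add: \<beta>_def power_divide)
  define x :: "'a \<Rightarrow> real" where "x i = (if i \<in> C then 1 else 0)" for i
  define y where "y e = (if e \<in> F then \<beta> else 0)" for e
  have fin: "finite C" using C simple finite_subset by blast
  have cardF: "2 * real (card F) = m * (m - 1)"
    using edge_sum_clique[OF simple(3) fin C(2), of "\<lambda>_. 1"]
    by (simp add: edge_sum_def F_def m_def power2_eq_square algebra_simps)
  have "(\<Sum>i\<in>V. (x i)\<^sup>2) = (\<Sum>i\<in>C. 1)"
    by (rule sum.mono_neutral_cong_right) (use simple C in \<open>auto simp: x_def\<close>)
  then have x2: "(\<Sum>i\<in>V. (x i)\<^sup>2) = m" by (simp add: m_def)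
  have "(\<Sum>e\<in>E. (y e)\<^sup>2) = (\<Sum>e\<in>F. \<beta>\<^sup>2)"
    by (rule sum.mono_neutral_cong_right) (use simple F in \<open>auto simp: y_def\<close>)
  then have y2: "(\<Sum>e\<in>E. (y e)\<^sup>2) = m / 2" using cardF \<beta> by simp algebra
  have "(\<Sum>e\<in>E. (\<Prod>i\<in>e. x i) * y e) = (\<Sum>e\<in>F. \<beta>)"
  proof (rule sum.mono_neutral_cong_right)
    fix e assume "e \<in> F"
    then have "(\<Prod>i\<in>e. x i) = 1" by (intro prod.neutral) (auto simp: x_def F_def)
    with \<open>e \<in> F\<close> show "(\<Prod>i\<in>e. x i) * y e = \<beta>" by (simp add: y_def)
  qed (use simple F in \<open>auto simp: y_def\<close>)
  then have q: "(\<Sum>e\<in>E. (\<Prod>i\<in>e. x i) * y e) = card F * \<beta>" by simp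
  have q2: "4 * (real (card F) * \<beta>)\<^sup>2 = m\<^sup>2 * (m - 1)" using cardF \<beta> by algebra
  define K where "K = real k"
  have K: "K > 1" using k by (simp add: K_def)
  have "27 * (2 * K / (K - 1)) * (real (card F) * \<beta>)\<^sup>2 \<le> 4 * (m + m / 2) ^ 3"
    using bound[of x y] by (simp only: x2 y2 q K_def)
  moreover have "4 * (m + m / 2) ^ 3 = 27 * m ^ 3 / 2" by (simp add: power3_eq_cube)
  ultimately have "2 * K / (K - 1) * (m\<^sup>2 * (m - 1)) \<le> 2 * m ^ 3"
    unfolding q2[symmetric] by simp
  then have "2 * (m\<^sup>2 * (K * (m - 1))) \<le> 2 * (m\<^sup>2 * (m * (K - 1)))"
    using K by (simp add: divide_simps power3_eq_cube power2_eq_square mult_ac right_diff_distrib)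
  then have "m\<^sup>2 * (K * (m - 1)) \<le> m\<^sup>2 * (m * (K - 1))" by linarith
  then have "K * (m - 1) \<le> m * (K - 1)"
    using m by (simp add: mult_le_cancel_left_pos)
  then show ?thesis by (simp add: m_def K_def algebra_simps)
qed

theorem proposition5p3:
  fixes V :: "'v set" and E :: "'v set set" and k :: nat
  assumes "simple_graph V E" and "k \<ge> 2"
  shows "hyperbolic (graph_coords V E) (p_form V E k) e0 \<longleftrightarrow> clique_number V E \<le> k"
  unfolding hyperbolic_p_form_iff[OF assms] clique_number_le_iff[OF simple_graphD(1)[OF assms(1)]]
proof (intro iffI allI impI)
  fix C
  assume "\<forall>x y. 27 * (2 * real k / (real k - 1)) * (\<Sum>e\<in>E. (\<Prod>i\<in>e. x i) * y e)\<^sup>2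
       \<le> 4 * ((\<Sum>i\<in>V. (x i)\<^sup>2) + (\<Sum>e\<in>E. (y e)\<^sup>2)) ^ 3"
    and C: "C \<subseteq> V" "clique C E"
  then have bound: "27 * (2 * real k / (real k - 1)) * (\<Sum>e\<in>E. (\<Prod>i\<in>e. x i) * y e)\<^sup>2
       \<le> 4 * ((\<Sum>i\<in>V. (x i)\<^sup>2) + (\<Sum>e\<in>E. (y e)\<^sup>2)) ^ 3" for x y
    by (elim allE)
  show "card C \<le> k"
    by (rule clique_card_bound[OF assms C bound])
next
  fix x y
  assume "\<forall>C\<subseteq>V. clique C E \<longrightarrow> card C \<le> k"
  then show "27 * (2 * real k / (real k - 1)) * (\<Sum>e\<in>E. (\<Prod>i\<in>e. x i) * y e)\<^sup>2
       \<le> 4 * ((\<Sum>i\<in>V. (x i)\<^sup>2) + (\<Sum>e\<in>E. (y e)\<^sup>2)) ^ 3"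
    by (rule graph_cubic_bound[OF assms])
qed

end
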